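(* Let a group $G$ act faithfully on each of two disjoint sets $S_1$ and $S_2$, and let $f\colon S_1\to S_2$ be a $G$-equivariant bijection. Let $\overline{S}:=S_1\sqcup S_2$ and let $\overline{f}:=f\sqcup f^{-1}\colon \overline{S}\to\overline{S}$, i.e. $\overline{f}(s)=f(s)$ for $s\in S_1$ and $\overline{f}(s)=f^{-1}(s)$ for $s\in S_2$. Let every $g\in G$ act on $\overline{S}$ as $g\sqcup g$ (its given action on $S_1$ and its given action on $S_2$); this action is faithful, and $G$ is regarded as a subgroup of $\mathrm{Sym}(\overline{S})$ via it. Let $\overline{G}:=\langle G,\overline{f}\rangle\le \mathrm{Sym}(\overline{S})$. Then: (1) $\overline{f}$ is a $G$-equivariant involution. (2) $G$ and $\langle\overline{f}\rangle$ commute in $\mathrm{Sym}(\overline{S})$, and $\overline{G}$ is an internal direct product of $G$ and $\langle\overline{f}\rangle$. Moreover, $\overline{G}$ is the disjoint union $\overline{G}=G\cup\overline{f}G=G\cup G\overline{f}$, where $G$ is exactly the set of those transformations in $\overline{G}$ that preserve $S_1$ and $S_2$, and the coset $\overline{f}G=G\overline{f}$ is exactly the set of those transformations in $\overline{G}$ that exchange $S_1$ and $S_2$. (3) There is a short exact sequence $$\{Id_{\overline{S}}\}\longrightarrow G\longrightarrow\overline{G}\longrightarrow\langle\overline{f}\rangle\longrightarrow\{Id_{\overline{S}}\},$$ where $G\to\overline{G}$ is the inclusion and $\overline{G}\to\langle\overline{f}\rangle$ is $g\overline{f}^i\mapsto\overline{f}^i$. This short exact sequence is left split, so is isomorphic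 to the direct product short exact sequence of $G$ and $\langle\overline{f}\rangle$. (4) If the action of $G$ on $S_1$ is simply transitive, then the action of $G$ on $S_2$ is also simply transitive, and the action of $\overline{G}$ on $\overline{S}$ is also simply transitive. (5) Suppose the action of $G$ on $S_1$ is simply transitive. Let $H$ be the centralizer of $G$ in $\mathrm{Sym}(S_1)$. Then $H$ is the Lewin dual group of $G$ (in $\mathrm{Sym}(S_1)$). Let $H$ act on $S_2$ via its embedded copy $fHf^{-1}\le\mathrm{Sym}(S_2)$ (so $h\in H$ acts on $S_2$ as $fhf^{-1}$), so that $f$ is $H$-equivariant, and regard $H$ as a subgroup of $\mathrm{Sym}(\overline{S})$ via $h\mapsto h\sqcup fhf^{-1}$. Let $\overline{H}:=\langle H,\overline{f}\rangle\le\mathrm{Sym}(\overline{S})$. Then $\overline{H}$ is the centralizer of $\overline{G}$ in $\mathrm{Sym}(\overline{S})$, so $\overline{H}$ and $\overline{G}$ are (Lewin) dual groups in $\mathrm{Sym}(\overline{S})$. Moreover: (i) $\overline{f}$ is $H$-equivariant. (ii) $H$ and $\langle\overline{f}\rangle$ commute in $\mathrm{Sym}(\overline{S})$, and $\overline{H}$ is an internal direct product of $H$ and $\langle\overline{f}\rangle$. Moreover $\overline{H}$ is the disjoint union $\overline{H}=H\cup\overline{f}H=H\cup H\overline{f}$, where $H$ is exactly the set of those transformations in $\overline{H}$ that preserve $S_1$ and $S_2$, and $\overline{f}H=H\overline{f}$ is exactly the set of those transformations in $\overline{H}$ that exchange $S_1$ and $S_2$. (iii) There is a left split short exact sequence $\{Id_{\overline{S}}\}\to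 H\to\overline{H}\to\langle\overline{f}\rangle\to\{Id_{\overline{S}}\}$ with first map the inclusion and second map $h\overline{f}^i\mapsto\overline{f}^i$, which is therefore isomorphic to the direct product short exact sequence of $H$ and $\langle\overline{f}\rangle$. (iv) The action of $H$ on $S_2$ is simply transitive, and the action of $\overline{H}$ on $\overline{S}$ is simply transitive. (6) Suppose again that the action of $G$ on $S_1$ is simply transitive, and let $H$ and its action on $S_2$ be as in (5). Let $h\in H$ and let $\overline{h}=h\sqcup fhf^{-1}$ be the extension of $h$ to $\overline{S}$. Then the function $\overline{f}\circ\overline{h}=\overline{h}\circ\overline{f}$ is $fh$ on $S_1$ and is $hf^{-1}$ on $S_2$.
   Context: All group actions are left actions. An action of $G$ on $S$ is faithful if the induced homomorphism $G\to\mathrm{Sym}(S)$ is injective; it is simply transitive if for all $s,s'\in S$ there is a unique $g\in G$ with $gs=s'$. A map $f$ between $G$-sets is $G$-equivariant if $f(gs)=gf(s)$ for all $g$ and $s$. Two subgroups $G$ and $H$ of a symmetric group $\mathrm{Sym}(S)$ are dual in the sense of Lewin (Lewin dual, or simply dual) if each acts simply transitively on $S$ and each is the centralizer of the other in $\mathrm{Sym}(S)$. A short exact sequence $1\to A\to B\to C\to 1$ of groups is left split if the homomorphism $A\to B$ has a left inverse homomorphism $B\to A$. A transformation of $\overline{S}=S_1\sqcup S_2$ preserves $S_1$ and $S_2$ if it maps each $S_j$ onto itself, and exchanges them if it maps $S_1$ onto $S_2$ and $S_2$ onto $S_1$. *)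

theory Defs
  imports "HOL-Algebra.Group_Action" "HOL-Algebra.Exact_Sequence"
begin

text \<open>
  The symmetric group on \<open>S\<close> is \<open>BijGroup S\<close>: its elements are extensional (\<open>undefined\<close> outside
  \<open>S\<close>) and its product is composition, so that a homomorphism into it is a left action.
\<close>

abbreviation perm_grp :: "'a set \<Rightarrow> ('a \<Rightarrow> 'a) set \<Rightarrow> ('a \<Rightarrow> 'a) monoid"
  where "perm_grp S K \<equiv> (BijGroup S)\<lparr>carrier := K\<rparr>"

locale simply_transitive_action = group_action +
  assumes simply_transitive:
    "\<lbrakk> x \<in> E; y \<in> E \<rbrakk> \<Longrightarrow> \<exists>!g. g \<in> carrier G \<and> (\<phi> g) x = y"

definition equivariant ::
  "('g, 'm) monoid_scheme \<Rightarrow> 'a set \<Rightarrow> ('g \<Rightarrow> 'a \<Rightarrow> 'a) \<Rightarrow> ('g \<Rightarrow> 'b \<Rightarrow> 'b) \<Rightarrow> ('a \<Rightarrow> 'b) \<Rightarrow> bool"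
  where "equivariant G S \<phi> \<psi> f \<longleftrightarrow> (\<forall>g\<in>carrier G. \<forall>s\<in>S. f (\<phi> g s) = \<psi> g (f s))"

definition centralizer :: "('g, 'm) monoid_scheme \<Rightarrow> 'g set \<Rightarrow> 'g set"
  where "centralizer G A = {x \<in> carrier G. \<forall>a\<in>A. x \<otimes>\<^bsub>G\<^esub> a = a \<otimes>\<^bsub>G\<^esub> x}"

definition lewin_dual :: "'a set \<Rightarrow> ('a \<Rightarrow> 'a) set \<Rightarrow> ('a \<Rightarrow> 'a) set \<Rightarrow> bool"
  where "lewin_dual S K L \<longleftrightarrow>
    subgroup K (BijGroup S) \<and> subgroup L (BijGroup S) \<and>
    simply_transitive_action (perm_grp S K) S (\<lambda>t. t) \<and>
    simply_transitive_action (perm_grp S L) S (\<lambda>t. t) \<and>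
    L = centralizer (BijGroup S) K \<and> K = centralizer (BijGroup S) L"

text \<open>For disjoint \<open>S1\<close> and \<open>S2\<close> this is the map \<open>a \<squnion> b\<close> on \<open>S1 \<union> S2\<close>.\<close>

definition glue :: "'a set \<Rightarrow> 'a set \<Rightarrow> ('a \<Rightarrow> 'b) \<Rightarrow> ('a \<Rightarrow> 'b) \<Rightarrow> 'a \<Rightarrow> 'b"
  where "glue S1 S2 a b = (\<lambda>s \<in> S1 \<union> S2. if s \<in> S1 then a s else b s)"

definition preserves :: "'a set \<Rightarrow> 'a set \<Rightarrow> ('a \<Rightarrow> 'a) \<Rightarrow> bool"
  where "preserves S1 S2 t \<longleftrightarrow> t ` S1 = S1 \<and> t ` S2 = S2"

definition exchanges :: "'a set \<Rightarrow> 'a set \<Rightarrow> ('a \<Rightarrow> 'a) \<Rightarrow> bool"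
  where "exchanges S1 S2 t \<longleftrightarrow> t ` S1 = S2 \<and> t ` S2 = S1"

definition internal_direct_product :: "('g, 'm) monoid_scheme \<Rightarrow> 'g set \<Rightarrow> 'g set \<Rightarrow> bool"
  where "internal_direct_product K A B \<longleftrightarrow>
    A \<lhd> K \<and> B \<lhd> K \<and> A \<inter> B = {\<one>\<^bsub>K\<^esub>} \<and> A <#>\<^bsub>K\<^esub> B = carrier K"

definition left_split ::
  "('a, 'm) monoid_scheme \<Rightarrow> ('a \<Rightarrow> 'b) \<Rightarrow> ('b, 'n) monoid_scheme \<Rightarrow> bool"
  where "left_split A i B \<longleftrightarrow> (\<exists>r\<in>hom B A. \<forall>a\<in>carrier A. r (i a) = a)"

text \<open>
  An isomorphism from the sequence \<open>A \<rightarrow> B \<rightarrow> C\<close>, with maps \<open>i\<close> and \<open>p\<close>, to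
  \<open>A \<rightarrow> A \<times> C \<rightarrow> C\<close>, with maps \<open>a \<mapsto> (a, 1)\<close> and \<open>snd\<close>, that is the identity on \<open>A\<close> and on \<open>C\<close>.
\<close>

definition iso_direct_product_seq ::
  "('a, 'm) monoid_scheme \<Rightarrow> ('a \<Rightarrow> 'b) \<Rightarrow> ('b, 'n) monoid_scheme \<Rightarrow> ('b \<Rightarrow> 'c) \<Rightarrow>
    ('c, 'k) monoid_scheme \<Rightarrow> bool"
  where "iso_direct_product_seq A i B p C \<longleftrightarrow>
    (\<exists>\<theta>\<in>iso B (A \<times>\<times> C).
      (\<forall>a\<in>carrier A. \<theta> (i a) = (a, \<one>\<^bsub>C\<^esub>)) \<and> (\<forall>b\<in>carrier B. snd (\<theta> b) = p b))"

end

theory Submission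
  imports Defs
begin

text \<open>
  Everything reduces to one construction. For a permutation \<open>h\<close> of \<open>S1\<close>, let \<open>double h\<close> be
  \<open>h \<squnion> f h f\<inverse>\<close> on \<open>S1 \<union> S2\<close>. Equivariance of \<open>f\<close> says precisely that \<open>g \<squnion> g\<close> is the double of the
  permutation by which \<open>g\<close> acts on \<open>S1\<close>. Hence \<open>G\<close> and \<open>H\<close> enter symmetrically: both are doubles of
  subgroups of \<open>Sym(S1)\<close>, and the group generated by the doubles of a subgroup \<open>P\<close> together with the
  involution \<open>swap = f \<squnion> f\<inverse>\<close> (the \<open>doubled_group\<close> of \<open>P\<close>) is studied once for all \<open>P\<close>.
  
  Doubling is an injective homomorphism, and doubles commute with the swap. Doubles preserve the two
  halves while the swap exchanges them. So the doubled group is the union of the doubles and one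
  coset, disjoint if the sets are nonempty, and is the internal direct product of the doubles and
  the group generated by the swap (\<open>adjoin_commuting_involution\<close>). Any internal direct product yields a split
  exact sequence that is isomorphic to the product sequence (\<open>internal_direct_product_split_exact\<close>).
  
  For duality, the key fact is that two commuting transitive subgroups of a symmetric group are
  each simply transitive and are each other's centralizers (\<open>lewin_dual_if_commuting_transitive\<close>).
  It shows that a simply transitive group is dual to its centralizer, once right translations have
  been used to see that the centralizer is transitive (\<open>lewin_dual_centralizer\<close>). It also shows
  that doubled groups of dual groups are dual, since commutation and transitivity pass directly to
  the doubled groups (\<open>lewin_dual_doubled_groups\<close>).
\<close>

section \<open>Commuting subgroups and internal direct products\<close>

lemma (in group) generate_involution:
  assumes "u \<in> carrier G" "u \<otimes> u = \<one>"
  shows "generate G {u} = {\<one>, u}"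
proof
  have "inv u = u"
    using assms inv_equality by blast
  then have "subgroup {\<one>, u} G"
    using assms by (intro subgroupI) auto
  then show "generate G {u} \<subseteq> {\<one>, u}"
    by (intro generate_subgroup_incl) auto
  show "{\<one>, u} \<subseteq> generate G {u}"
    by (auto intro: generate.intros)
qed

text \<open>
  For elementwise commuting subgroups the product set is closed under the operations, because
  \<open>ab \<cdot> cd = ac \<cdot> bd\<close> and \<open>(ab)\<inverse> = a\<inverse>b\<inverse>\<close>.
\<close>

lemma (in group) subgroup_set_mult_if_commuting:
  assumes A: "subgroup A G" and B: "subgroup B G"
    and comm: "\<And>a b. \<lbrakk> a \<in> A; b \<in> B \<rbrakk> \<Longrightarrow> a \<otimes> b = b \<otimes> a"
  shows "subgroup (A <#> B) G"
proof (rule subgroupI)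
  interpret A: subgroup A G by fact
  interpret B: subgroup B G by fact
  show "A <#> B \<subseteq> carrier G"
    using A.subset B.subset by (rule set_mult_closed)
  show "A <#> B \<noteq> {}"
    using A.one_closed B.one_closed unfolding set_mult_def by blast
  fix x assume "x \<in> A <#> B"
  then obtain a b where x: "x = a \<otimes> b" and ab: "a \<in> A" "b \<in> B"
    by (auto simp: set_mult_def)
  then have "inv x = inv a \<otimes> inv b"
    using comm by (metis A.mem_carrier B.mem_carrier inv_mult_group)
  then show "inv x \<in> A <#> B"
    using ab by (auto simp: set_mult_def)
  fix y assume "y \<in> A <#> B"
  then obtain c d where y: "y = c \<otimes> d" and cd: "c \<in> A" "d \<in> B"
    by (auto simp: set_mult_def)
  have "x \<otimes> y = a \<otimes> (b \<otimes> c) \<otimes> d"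
    using x y ab cd by (simp add: m_assoc)
  also have "\<dots> = (a \<otimes> c) \<otimes> (b \<otimes> d)"
    using ab cd comm[of c b, symmetric] by (simp add: m_assoc)
  finally show "x \<otimes> y \<in> A <#> B"
    using ab cd by (auto simp: set_mult_def)
qed

lemma (in group) internal_direct_product_if_commuting:
  assumes A: "subgroup A G" and B: "subgroup B G" and triv: "A \<inter> B \<subseteq> {\<one>}"
    and comm: "\<And>a b. \<lbrakk> a \<in> A; b \<in> B \<rbrakk> \<Longrightarrow> a \<otimes> b = b \<otimes> a"
    and K: "subgroup K G" "K = A <#> B"
  shows "internal_direct_product (G\<lparr>carrier := K\<rparr>) A B"
proof -
  have sub: "A \<subseteq> K" "B \<subseteq> K"
    using subgroup.one_closed[OF A] subgroup.one_closed[OF B]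
      subgroup.subset[OF A] subgroup.subset[OF B]
    unfolding K set_mult_def by force+
  interpret K: group "G\<lparr>carrier := K\<rparr>"
    using K(1) by (rule subgroup_imp_group)
  interpret group_disjoint_sum "G\<lparr>carrier := K\<rparr>" A B
    using A B K(1) sub by (simp add: group_disjoint_sum_def K.group_axioms subgroup_incl)
  have "A <#>\<^bsub>G\<lparr>carrier := K\<rparr>\<^esub> B = K"
    unfolding K by (simp add: set_mult_def)
  moreover have "A \<inter> B = {\<one>\<^bsub>G\<lparr>carrier := K\<rparr>\<^esub>}"
    using triv subgroup.one_closed[OF A] subgroup.one_closed[OF B] by auto
  moreover have "\<forall>a\<in>A. \<forall>b\<in>B. a \<otimes> b = b \<otimes> a"
    using comm by blast
  ultimately show ?thesis
    unfolding internal_direct_product_def using normal_eq_commuting by simp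
qed

text \<open>
  Adjoining a commuting involution \<open>u\<close> enlarges \<open>A\<close> by the single coset \<open>uA\<close>, since \<open>A\<close> and
  \<open>\<langle>u\<rangle> = {1, u}\<close> are commuting subgroups with product \<open>A \<union> uA\<close>. The last hypothesis forces
  \<open>A \<inter> \<langle>u\<rangle> = 1\<close>; it is an implication so that the degenerate case \<open>u = 1\<close> is covered as well.
\<close>

lemma (in group) adjoin_commuting_involution:
  assumes A: "subgroup A G" and u: "u \<in> carrier G" "u \<otimes> u = \<one>"
    and comm: "\<And>a. a \<in> A \<Longrightarrow> a \<otimes> u = u \<otimes> a"
    and triv: "u \<in> A \<Longrightarrow> u = \<one>"
  shows "u <# A = A #> u"
    and "generate G (A \<union> {u}) = A \<union> (u <# A)"
    and "\<forall>a\<in>A. \<forall>t\<in>generate G {u}. a \<otimes> t = t \<otimes> a"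
    and "internal_direct_product (G\<lparr>carrier := generate G (A \<union> {u})\<rparr>) A (generate G {u})"
proof -
  let ?E = "generate G (A \<union> {u})"
  have AG: "a \<in> carrier G" if "a \<in> A" for a
    using that subgroup.subset[OF A] by auto
  have F: "generate G {u} = {\<one>, u}"
    using u by (rule generate_involution)
  show coset: "u <# A = A #> u"
    using comm unfolding l_coset_def r_coset_def by auto
  have E: "subgroup ?E G"
    using AG u by (intro generate_is_subgroup) auto
  have subF: "subgroup (generate G {u}) G"
    using u by (intro generate_is_subgroup) auto
  show cF: "\<forall>a\<in>A. \<forall>t\<in>generate G {u}. a \<otimes> t = t \<otimes> a"
    using comm AG unfolding F by auto
  have AF: "A <#> generate G {u} = A \<union> (u <# A)"
    using AG unfolding coset F set_mult_def r_coset_def by auto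
  have "subgroup (A <#> generate G {u}) G"
    using A subF cF by (intro subgroup_set_mult_if_commuting) auto
  then have "?E \<subseteq> A <#> generate G {u}"
    by (intro generate_subgroup_incl)
      (use AG u subgroup.one_closed[OF A] in \<open>auto simp: AF l_coset_def\<close>)
  moreover have "A \<union> (u <# A) \<subseteq> ?E"
    by (auto simp: l_coset_def intro: generate.intros)
  ultimately show EA: "generate G (A \<union> {u}) = A \<union> (u <# A)"
    using AF by auto
  show "internal_direct_product (G\<lparr>carrier := generate G (A \<union> {u})\<rparr>) A (generate G {u})"
    using internal_direct_product_if_commuting[OF A subF _ _ E] cF triv EA AF
    by (auto simp: F)
qed

text \<open>
  The multiplication map \<open>A \<times> B \<rightarrow> K\<close> is an isomorphism. The two coordinates of its inverse \<open>\<theta>\<close> are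
  the retraction onto \<open>A\<close> and the projection \<open>\<pi>\<close> onto \<open>B\<close>, and \<open>\<theta>\<close> itself is the isomorphism with
  the direct product sequence.
\<close>

lemma internal_direct_product_split_exact:
  fixes K :: "'a monoid"
  assumes "group K" and idp: "internal_direct_product K A B"
  shows "\<exists>\<pi>. (\<forall>a\<in>A. \<forall>b\<in>B. \<pi> (a \<otimes>\<^bsub>K\<^esub> b) = b) \<and>
    exact_seq
      ([K\<lparr>carrier := {\<one>\<^bsub>K\<^esub>}\<rparr>, K\<lparr>carrier := B\<rparr>, K, K\<lparr>carrier := A\<rparr>, K\<lparr>carrier := {\<one>\<^bsub>K\<^esub>}\<rparr>],
       [\<lambda>_. \<one>\<^bsub>K\<^esub>, \<pi>, \<lambda>t. t, \<lambda>t. t]) \<and>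
    left_split (K\<lparr>carrier := A\<rparr>) (\<lambda>t. t) K \<and>
    iso_direct_product_seq (K\<lparr>carrier := A\<rparr>) (\<lambda>t. t) K \<pi> (K\<lparr>carrier := B\<rparr>)"
proof -
  interpret K: group K by fact
  have AB: "A \<lhd> K" "B \<lhd> K" "A \<inter> B = {\<one>\<^bsub>K\<^esub>}" "A <#>\<^bsub>K\<^esub> B = carrier K"
    using idp by (auto simp: internal_direct_product_def)
  interpret A: normal A K by fact
  interpret B: normal B K by fact
  interpret group_disjoint_sum K A B ..
  let ?A = "K\<lparr>carrier := A\<rparr>" and ?B = "K\<lparr>carrier := B\<rparr>" and ?I = "K\<lparr>carrier := {\<one>\<^bsub>K\<^esub>}\<rparr>"
  let ?m = "\<lambda>(a, b). a \<otimes>\<^bsub>K\<^esub> b"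
  have grp: "group ?A" "group ?B" "group ?I"
    using K.subgroup_imp_group A.subgroup_axioms B.subgroup_axioms K.triv_subgroup by auto
  have gen: "subgroup_generated K A = ?A" "subgroup_generated K B = ?B"
    using A.carrier_subgroup_generated_subgroup B.carrier_subgroup_generated_subgroup
    by (simp_all add: subgroup_generated_def)
  have m: "?m \<in> iso (?A \<times>\<times> ?B) K"
    using iso_group_mul_eq AB unfolding gen by blast
  define \<theta> where "\<theta> = inv_into (A \<times> B) ?m"
  have \<theta>: "\<theta> \<in> iso K (?A \<times>\<times> ?B)"
    using group.iso_set_sym[OF DirProd_group[OF grp(1,2)] m] by (simp add: \<theta>_def)
  have "inj_on ?m (A \<times> B)"
    using m by (auto simp: iso_def bij_betw_def)
  then have \<theta>_mult: "\<theta> (a \<otimes>\<^bsub>K\<^esub> b) = (a, b)" if "a \<in> A" "b \<in> B" for a b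
    unfolding \<theta>_def using that inv_into_f_f[of ?m "A \<times> B" "(a, b)"] by simp
  have \<theta>_A: "\<theta> a = (a, \<one>\<^bsub>K\<^esub>)" if "a \<in> A" for a
    using \<theta>_mult[OF that B.one_closed] that by simp
  have hom: "fst \<circ> \<theta> \<in> hom K ?A" "snd \<circ> \<theta> \<in> hom K ?B"
    using \<theta> by (auto simp: iso_def hom_def Pi_iff mult_DirProd' mem_Times_iff)
  have hom1: "(\<lambda>_. \<one>\<^bsub>K\<^esub>) \<in> hom ?B ?I" "(\<lambda>t. t) \<in> hom ?A K" "(\<lambda>t. t) \<in> hom ?I ?A"
    by (auto simp: hom_def)
  have onto: "b \<in> (snd \<circ> \<theta>) ` carrier K" if "b \<in> B" for b
  proof (rule image_eqI)
    show "b = (snd \<circ> \<theta>) b"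
      using \<theta>_mult[OF A.one_closed that] that by simp
  qed (use that in simp)
  have kernel: "kernel K ?B (snd \<circ> \<theta>) = A"
  proof
    show "A \<subseteq> kernel K ?B (snd \<circ> \<theta>)"
      by (auto simp: kernel_def \<theta>_A)
    show "kernel K ?B (snd \<circ> \<theta>) \<subseteq> A"
    proof
      fix x assume "x \<in> kernel K ?B (snd \<circ> \<theta>)"
      then have x: "x \<in> A <#>\<^bsub>K\<^esub> B" "snd (\<theta> x) = \<one>\<^bsub>K\<^esub>"
        using AB(4) by (auto simp: kernel_def)
      then show "x \<in> A"
        by (auto simp: set_mult_def \<theta>_mult)
    qed
  qed
  show ?thesis
  proof (intro exI[of _ "snd \<circ> \<theta>"] conjI)
    show "\<forall>a\<in>A. \<forall>b\<in>B. (snd \<circ> \<theta>) (a \<otimes>\<^bsub>K\<^esub> b) = b"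
      by (simp add: \<theta>_mult)
    have "kernel ?B ?I (\<lambda>_. \<one>\<^bsub>K\<^esub>) = (snd \<circ> \<theta>) ` carrier K"
      using onto hom(2) by (auto simp: kernel_def hom_def)
    moreover have "kernel ?A K (\<lambda>t. t) = {\<one>\<^bsub>K\<^esub>}"
      by (auto simp: kernel_def)
    ultimately show "exact_seq ([?I, ?B, K, ?A, ?I], [\<lambda>_. \<one>\<^bsub>K\<^esub>, snd \<circ> \<theta>, \<lambda>t. t, \<lambda>t. t])"
      using grp hom hom1 kernel
      by (auto simp: K.group_axioms group_hom_def group_hom_axioms_def)
    show "left_split ?A (\<lambda>t. t) K"
      unfolding left_split_def using hom(1) \<theta>_A by (intro bexI[of _ "fst \<circ> \<theta>"]) auto
    show "iso_direct_product_seq ?A (\<lambda>t. t) K (snd \<circ> \<theta>) ?B"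
      unfolding iso_direct_product_seq_def using \<theta> \<theta>_A by (intro bexI[of _ \<theta>]) auto
  qed
qed

section \<open>Commuting transitive permutation groups\<close>

lemma (in group) subgroup_centralizer:
  assumes "A \<subseteq> carrier G"
  shows "subgroup (centralizer G A) G"
proof (rule subgroupI)
  show "centralizer G A \<noteq> {}"
    using assms unfolding centralizer_def by (auto intro!: exI[of _ \<one>])
  fix x assume x: "x \<in> centralizer G A"
  have "inv x \<otimes> a = a \<otimes> inv x" if "a \<in> A" for a
  proof -
    have "a \<in> carrier G" "x \<in> carrier G" "x \<otimes> a = a \<otimes> x"
      using that x assms by (auto simp: centralizer_def)
    then show ?thesis
      by (metis inv_closed inv_solve_left inv_solve_right m_assoc m_closed)
  qed
  then show "inv x \<in> centralizer G A"
    using x by (simp add: centralizer_def)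
  fix y assume y: "y \<in> centralizer G A"
  show "x \<otimes> y \<in> centralizer G A"
    using x y assms unfolding centralizer_def
    by (auto simp: subset_iff) (metis m_assoc)
qed (auto simp: centralizer_def)

lemma BijGroup_apply:
  "\<lbrakk> x \<in> carrier (BijGroup S); y \<in> carrier (BijGroup S); s \<in> S \<rbrakk>
    \<Longrightarrow> (x \<otimes>\<^bsub>BijGroup S\<^esub> y) s = x (y s)"
  by (simp add: BijGroup_def compose_eq)

lemma BijGroup_one_apply: "s \<in> S \<Longrightarrow> \<one>\<^bsub>BijGroup S\<^esub> s = s"
  by (simp add: BijGroup_def)

lemma BijGroup_closed: "\<lbrakk> x \<in> carrier (BijGroup S); s \<in> S \<rbrakk> \<Longrightarrow> x s \<in> S"
  using Bij_imp_funcset by (fastforce simp: BijGroup_def)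

lemma BijGroup_eqI:
  assumes "x \<in> carrier (BijGroup S)" "y \<in> carrier (BijGroup S)" "\<And>s. s \<in> S \<Longrightarrow> x s = y s"
  shows "x = y"
  using assms by (auto simp: BijGroup_def intro: extensionalityI[OF Bij_imp_extensional Bij_imp_extensional])

lemma BijGroup_commute_iff:
  assumes "x \<in> carrier (BijGroup S)" "y \<in> carrier (BijGroup S)"
  shows "x \<otimes>\<^bsub>BijGroup S\<^esub> y = y \<otimes>\<^bsub>BijGroup S\<^esub> x \<longleftrightarrow> (\<forall>s\<in>S. x (y s) = y (x s))"
proof
  interpret group "BijGroup S" by (rule group_BijGroup)
  show "x \<otimes>\<^bsub>BijGroup S\<^esub> y = y \<otimes>\<^bsub>BijGroup S\<^esub> x" if "\<forall>s\<in>S. x (y s) = y (x s)"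
    using that assms by (intro BijGroup_eqI) (auto simp: BijGroup_apply)
qed (use assms BijGroup_apply in metis)

lemma group_action_perm_grp:
  assumes "subgroup P (BijGroup S)" "\<psi> \<in> hom (BijGroup S) (BijGroup T)"
  shows "group_action (perm_grp S P) T \<psi>"
proof -
  interpret B: group "BijGroup S" by (rule group_BijGroup)
  have "\<psi> \<in> hom (perm_grp S P) (BijGroup T)"
    using assms subgroup.mem_carrier[OF assms(1)] by (auto simp: hom_def)
  then show ?thesis
    using assms(1) group_BijGroup B.subgroup_imp_group
    by (auto simp: group_action_def group_hom_def group_hom_axioms_def)
qed

lemma simply_transitive_perm_grp_iff:
  assumes "subgroup P (BijGroup S)"
  shows "simply_transitive_action (perm_grp S P) S (\<lambda>t. t) \<longleftrightarrow>
    (\<forall>x\<in>S. \<forall>y\<in>S. \<exists>!p. p \<in> P \<and> p x = y)"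
  using group_action_perm_grp[OF assms, of "\<lambda>t. t" S]
  by (simp add: simply_transitive_action_def simply_transitive_action_axioms_def hom_def Ball_def)

text \<open>
  A permutation commuting with \<open>Q\<close> is determined by its value at one point \<open>x\<close> whose \<open>Q\<close>-orbit is
  everything: it must send \<open>q x\<close> to \<open>q\<close> applied to that value.
\<close>

lemma commuting_with_transitive_eqI:
  assumes trans: "\<And>y. y \<in> S \<Longrightarrow> \<exists>q\<in>Q. q x = y"
    and x: "x \<in> S" and Q: "Q \<subseteq> carrier (BijGroup S)"
    and a: "a \<in> centralizer (BijGroup S) Q" and b: "b \<in> centralizer (BijGroup S) Q"
    and eq: "a x = b x"
  shows "a = b"
proof (rule BijGroup_eqI[where S = S])
  show ab: "a \<in> carrier (BijGroup S)" "b \<in> carrier (BijGroup S)"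
    using a b by (auto simp: centralizer_def)
  fix y assume "y \<in> S"
  then obtain q where q: "q \<in> Q" "q x = y"
    using trans by blast
  have "c y = q (c x)" if "c \<in> centralizer (BijGroup S) Q" for c
    using that q x Q BijGroup_commute_iff[of c S q] by (auto simp: centralizer_def)
  then show "a y = b y"
    using a b eq by metis
qed

text \<open>
  Duality needs only that two transitive groups commute. If \<open>t\<close> centralizes \<open>Q\<close>, transitivity of \<open>P\<close>
  gives \<open>p \<in> P\<close> agreeing with \<open>t\<close> at a point, and \<open>t = p\<close> because both commute with the transitive
  group \<open>Q\<close>. The same uniqueness principle makes the action of \<open>P\<close> free.
\<close>

lemma lewin_dual_if_commuting_transitive:
  assumes P: "subgroup P (BijGroup S)" and Q: "subgroup Q (BijGroup S)"
    and transP: "\<And>x y. \<lbrakk> x \<in> S; y \<in> S \<rbrakk> \<Longrightarrow> \<exists>p\<in>P. p x = y"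
    and transQ: "\<And>x y. \<lbrakk> x \<in> S; y \<in> S \<rbrakk> \<Longrightarrow> \<exists>q\<in>Q. q x = y"
    and comm: "\<And>p q. \<lbrakk> p \<in> P; q \<in> Q \<rbrakk> \<Longrightarrow> p \<otimes>\<^bsub>BijGroup S\<^esub> q = q \<otimes>\<^bsub>BijGroup S\<^esub> p"
  shows "lewin_dual S P Q"
proof -
  have half: "simply_transitive_action (perm_grp S P) S (\<lambda>t. t) \<and> P = centralizer (BijGroup S) Q"
    if P: "subgroup P (BijGroup S)" and Q: "subgroup Q (BijGroup S)"
      and transP: "\<And>x y. \<lbrakk> x \<in> S; y \<in> S \<rbrakk> \<Longrightarrow> \<exists>p\<in>P. p x = y"
      and transQ: "\<And>x y. \<lbrakk> x \<in> S; y \<in> S \<rbrakk> \<Longrightarrow> \<exists>q\<in>Q. q x = y"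
      and comm: "\<And>p q. \<lbrakk> p \<in> P; q \<in> Q \<rbrakk> \<Longrightarrow> p \<otimes>\<^bsub>BijGroup S\<^esub> q = q \<otimes>\<^bsub>BijGroup S\<^esub> p"
    for P Q
  proof -
    have sub: "P \<subseteq> centralizer (BijGroup S) Q"
      using comm subgroup.subset[OF P] by (auto simp: centralizer_def)
    have eqI: "a = b"
      if "a \<in> centralizer (BijGroup S) Q" "b \<in> centralizer (BijGroup S) Q" "x \<in> S" "a x = b x"
      for a b x
      using commuting_with_transitive_eqI[OF transQ] that subgroup.subset[OF Q] by blast
    have "t \<in> P" if t: "t \<in> centralizer (BijGroup S) Q" for t
    \<comment> \<open>on the empty set there is no point to compare at, but there is only one permutation\<close>
    proof (cases "S = {}")
      case True
      obtain p where "p \<in> P"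
        using subgroup.one_closed[OF P] by blast
      moreover have "t = p"
        using True t \<open>p \<in> P\<close> subgroup.subset[OF P]
        by (intro BijGroup_eqI[where S = S]) (auto simp: centralizer_def)
      ultimately show ?thesis by simp
    next
      case False
      then obtain x where x: "x \<in> S" by blast
      have "t x \<in> S"
        using BijGroup_closed[OF _ x] t by (auto simp: centralizer_def)
      then obtain p where p: "p \<in> P" "p x = t x"
        using transP x by blast
      then have "p = t"
        using sub by (intro eqI[OF _ t x]) blast+
      then show ?thesis
        using p by simp
    qed
    then have "P = centralizer (BijGroup S) Q"
      using sub by blast
    moreover have "\<exists>!p. p \<in> P \<and> p x = y" if "x \<in> S" "y \<in> S" for x y
      using transP[OF that] eqI sub that by blast
    ultimately show ?thesis
      using simply_transitive_perm_grp_iff[OF P] by simp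
  qed
  have "simply_transitive_action (perm_grp S P) S (\<lambda>t. t) \<and> P = centralizer (BijGroup S) Q"
    by (rule half[OF P Q transP transQ comm])
  moreover
  have "simply_transitive_action (perm_grp S Q) S (\<lambda>t. t) \<and> Q = centralizer (BijGroup S) P"
    by (rule half[OF Q P transQ transP comm[symmetric]])
  ultimately show ?thesis
    using P Q unfolding lewin_dual_def by blast
qed

lemma lewin_dual_sym: "lewin_dual S P Q \<Longrightarrow> lewin_dual S Q P"
  unfolding lewin_dual_def by blast

lemma lewin_dualD:
  assumes "lewin_dual S P Q"
  shows "P = centralizer (BijGroup S) Q"
    and "simply_transitive_action (perm_grp S P) S (\<lambda>t. t)"
    and "simply_transitive_action (perm_grp S Q) S (\<lambda>t. t)"
  using assms unfolding lewin_dual_def by blast+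

text \<open>
  The centralizer of a simply transitive group is transitive: identify \<open>S\<close> with \<open>P\<close> through the
  orbit map of \<open>x\<close>; then right translations of \<open>P\<close> commute with \<open>P\<close>, and a suitable one carries \<open>x\<close>
  to \<open>y\<close>.
\<close>

lemma lewin_dual_centralizer:
  assumes P: "subgroup P (BijGroup S)"
    and st: "simply_transitive_action (perm_grp S P) S (\<lambda>t. t)"
  shows "lewin_dual S P (centralizer (BijGroup S) P)"
proof -
  interpret B: group "BijGroup S" by (rule group_BijGroup)
  interpret P: subgroup P "BijGroup S" by fact
  have ex1: "\<exists>!p. p \<in> P \<and> p x = y" if "x \<in> S" "y \<in> S" for x y
    using bspec[OF bspec[OF iffD1[OF simply_transitive_perm_grp_iff[OF P] st]]] that .
  have trans: "\<exists>h\<in>centralizer (BijGroup S) P. h x = y" if x: "x \<in> S" and y: "y \<in> S" for x y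
  proof -
    have S: "p s \<in> S" if "p \<in> P" "s \<in> S" for p s
      using BijGroup_closed[OF P.mem_carrier[OF that(1)] that(2)] .
    \<comment> \<open>the right translation \<open>p x \<mapsto> p y\<close>, well defined because \<open>P\<close> acts freely\<close>
    define slide where "slide x y = (\<lambda>s\<in>S. (THE p. p \<in> P \<and> p x = s) y)" for x y
    have slide: "slide x y (p x) = p y" if "p \<in> P" "x \<in> S" for p x y
    proof -
      have "p x \<in> S"
        using that by (rule S)
      moreover from this have "(THE q. q \<in> P \<and> q x = p x) = p"
        using that ex1[of x "p x"] by (intro the1_equality) auto
      ultimately show ?thesis
        by (simp add: slide_def)
    qed
    have orbit: "\<exists>p\<in>P. s = p z" if "z \<in> S" "s \<in> S" for s z
      using ex1[OF that] by blast
    have slide_slide: "slide y x (slide x y s) = s \<and> slide x y s \<in> S"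
      if "x \<in> S" "y \<in> S" "s \<in> S" for x y s
    proof -
      obtain p where "p \<in> P" "s = p x"
        using orbit[OF \<open>x \<in> S\<close> \<open>s \<in> S\<close>] by blast
      then show ?thesis
        using that S by (simp add: slide)
    qed
    have "bij_betw (slide x y) S S"
      using slide_slide x y by (intro bij_betw_byWitness[where f' = "slide y x"]) blast+
    then have carrier: "slide x y \<in> carrier (BijGroup S)"
      by (simp add: BijGroup_def Bij_def slide_def)
    have "slide x y (q s) = q (slide x y s)" if "q \<in> P" "s \<in> S" for q s
    proof -
      obtain p where p: "p \<in> P" "s = p x"
        using orbit[OF x \<open>s \<in> S\<close>] by blast
      then have "slide x y (q s) = slide x y ((q \<otimes>\<^bsub>BijGroup S\<^esub> p) x)"
        using that x by (simp add: BijGroup_apply)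
      also have "\<dots> = (q \<otimes>\<^bsub>BijGroup S\<^esub> p) y"
        using that p x by (intro slide) auto
      also have "\<dots> = q (slide x y s)"
        using p that x y by (simp add: BijGroup_apply slide)
      finally show ?thesis .
    qed
    then have "slide x y \<in> centralizer (BijGroup S) P"
      using carrier by (auto simp: centralizer_def BijGroup_commute_iff)
    moreover have "slide x y x = y"
      using slide[OF P.one_closed x, of y] x y by (simp add: BijGroup_one_apply)
    ultimately show ?thesis by blast
  qed
  show ?thesis
  proof (rule lewin_dual_if_commuting_transitive)
    show "subgroup (centralizer (BijGroup S) P) (BijGroup S)"
      by (rule B.subgroup_centralizer) (rule P.subset)
    show "\<exists>p\<in>P. p x = y" if "x \<in> S" "y \<in> S" for x y
      using ex1[OF that] by blast
    show "\<exists>h\<in>centralizer (BijGroup S) P. h x = y" if "x \<in> S" "y \<in> S" for x y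
      using that by (rule trans)
    show "p \<otimes>\<^bsub>BijGroup S\<^esub> q = q \<otimes>\<^bsub>BijGroup S\<^esub> p"
      if "p \<in> P" "q \<in> centralizer (BijGroup S) P" for p q
      using that by (simp add: centralizer_def)
  qed (rule P)
qed

lemma (in group_action) subgroup_image: "subgroup (\<phi> ` carrier G) (BijGroup E)"
  using group_hom by (rule group_hom.img_is_subgroup)

lemma (in simply_transitive_action) simply_transitive_image:
  "simply_transitive_action (perm_grp E (\<phi> ` carrier G)) E (\<lambda>t. t)"
  unfolding simply_transitive_perm_grp_iff[OF subgroup_image]
proof (intro ballI)
  fix x y assume "x \<in> E" "y \<in> E"
  then obtain g where "g \<in> carrier G" "\<phi> g x = y"
    and "\<And>g'. \<lbrakk> g' \<in> carrier G; \<phi> g' x = y \<rbrakk> \<Longrightarrow> g' = g"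
    using simply_transitive by metis
  then show "\<exists>!p. p \<in> \<phi> ` carrier G \<and> p x = y"
    by (intro ex1I[of _ "\<phi> g"]) blast+
qed

lemma simply_transitive_equivariant:
  assumes st: "simply_transitive_action G S \<phi>" and act: "group_action G T \<psi>"
    and bij: "bij_betw f S T" and equiv: "equivariant G S \<phi> \<psi> f"
  shows "simply_transitive_action G T \<psi>"
proof -
  interpret S: simply_transitive_action G S \<phi> by fact
  have "\<exists>!g. g \<in> carrier G \<and> \<psi> g x = y" if "x \<in> T" "y \<in> T" for x y
  proof -
    have "x \<in> f ` S" "y \<in> f ` S"
      using that bij_betw_imp_surj_on[OF bij] by simp_all
    then obtain a b where ab: "x = f a" "y = f b" "a \<in> S" "b \<in> S"
      by blast
    have "\<psi> g x = y \<longleftrightarrow> \<phi> g a = b" if "g \<in> carrier G" for g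
    proof -
      have "\<psi> g x = f (\<phi> g a)"
        using equiv that ab by (simp add: equivariant_def)
      moreover have "\<phi> g a \<in> S"
        using S.element_image[OF that ab(3) refl] .
      ultimately show ?thesis
        using ab(2,4) inj_on_eq_iff[OF bij_betw_imp_inj_on[OF bij]] by metis
    qed
    then show ?thesis
      using S.simply_transitive[OF ab(3,4)] by (simp cong: conj_cong)
  qed
  then show ?thesis
    using act by (simp add: simply_transitive_action_def simply_transitive_action_axioms_def)
qed

section \<open>Doubling permutations along a bijection\<close>

lemma (in group) commuting_generate:
  assumes A: "A \<subseteq> carrier G" and B: "B \<subseteq> carrier G"
    and comm: "\<And>a b. \<lbrakk> a \<in> A; b \<in> B \<rbrakk> \<Longrightarrow> a \<otimes> b = b \<otimes> a"
    and x: "x \<in> generate G A" and y: "y \<in> generate G B"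
  shows "x \<otimes> y = y \<otimes> x"
proof -
  have "generate G A \<subseteq> centralizer G B"
    using A comm by (intro generate_subgroup_incl subgroup_centralizer B) (auto simp: centralizer_def)
  then have "B \<subseteq> centralizer G (generate G A)"
    using B by (fastforce simp: centralizer_def)
  then have "generate G B \<subseteq> centralizer G (generate G A)"
    by (intro generate_subgroup_incl subgroup_centralizer generate_incl A)
  then show ?thesis
    using x y by (fastforce simp: centralizer_def)
qed

lemma BijGroup_empty_eq:
  "\<lbrakk> x \<in> carrier (BijGroup {}); y \<in> carrier (BijGroup {}) \<rbrakk> \<Longrightarrow> x = y"
  by (rule BijGroup_eqI[where S = "{}"]) auto

text \<open>
  Two disjoint sets identified by a bijection \<open>f\<close>. The map \<open>swap\<close> is the involution
  \<open>f \<squnion> f\<inverse>\<close>, \<open>transport h\<close> is \<open>f h f\<inverse>\<close> on the second set, and \<open>double h\<close> is \<open>h \<squnion> f h f\<inverse>\<close>.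
  Every point of the union is \<open>a\<close> or \<open>f a\<close> with \<open>a\<close> in the first set, and on points of these two
  kinds all three maps are given by formulas free of \<open>f\<inverse>\<close>; identities between permutations of the
  union are checked there.
\<close>

locale doubled_set =
  fixes S1 S2 :: "'a set" and f :: "'a \<Rightarrow> 'a"
  assumes disjoint: "S1 \<inter> S2 = {}" and bij: "bij_betw f S1 S2"
begin

abbreviation S where "S \<equiv> S1 \<union> S2"

definition swap where "swap = glue S1 S2 f (inv_into S1 f)"

definition transport where "transport h = (\<lambda>s\<in>S2. f (h (inv_into S1 f s)))"

definition double where "double h = glue S1 S2 h (transport h)"

sublocale B1: group "BijGroup S1" by (rule group_BijGroup)
sublocale B: group "BijGroup S" by (rule group_BijGroup)

lemma f_in: "a \<in> S1 \<Longrightarrow> f a \<in> S2"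
  using bij by (rule bij_betw_apply)

lemma f_notin: "a \<in> S1 \<Longrightarrow> f a \<notin> S1"
  using f_in disjoint by blast

lemma f_eq_iff: "\<lbrakk> a \<in> S1; b \<in> S1 \<rbrakk> \<Longrightarrow> f a = f b \<longleftrightarrow> a = b"
  using bij_betw_imp_inj_on[OF bij] by (rule inj_on_eq_iff)

lemma f_cases:
  assumes "s \<in> S2" obtains a where "a \<in> S1" "s = f a"
  using assms bij_betw_imp_surj_on[OF bij] by blast

lemma S_cases:
  assumes "s \<in> S" obtains a where "a \<in> S1" "s = a \<or> s = f a"
  using assms bij_betw_imp_surj_on[OF bij] by blast

lemma inv_f: "a \<in> S1 \<Longrightarrow> inv_into S1 f (f a) = a"
  using bij_betw_imp_inj_on[OF bij] by (rule inv_into_f_f)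

lemma swap_apply: "a \<in> S1 \<Longrightarrow> swap a = f a" "a \<in> S1 \<Longrightarrow> swap (f a) = a"
  by (simp_all add: swap_def glue_def f_in f_notin inv_f)

lemma transport_apply: "a \<in> S1 \<Longrightarrow> transport h (f a) = f (h a)"
  by (simp add: transport_def f_in inv_f)

lemma double_apply:
  "a \<in> S1 \<Longrightarrow> double h a = h a" "a \<in> S1 \<Longrightarrow> double h (f a) = f (h a)"
  by (simp_all add: double_def glue_def f_in f_notin transport_apply)

lemma swap_image: "swap ` S1 = S2" "swap ` S2 = S1"
proof -
  have "swap ` S1 = f ` S1"
    by (rule image_cong) (simp_all add: swap_apply)
  then show "swap ` S1 = S2"
    by (simp add: bij_betw_imp_surj_on[OF bij])
  have "swap ` f ` S1 = id ` S1"
    unfolding image_image by (rule image_cong) (simp_all add: swap_apply)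
  then show "swap ` S2 = S1"
    by (simp add: bij_betw_imp_surj_on[OF bij])
qed

lemma swap_carrier: "swap \<in> carrier (BijGroup S)"
proof -
  have "swap (swap s) = s \<and> swap s \<in> S" if s: "s \<in> S" for s
    using s by (rule S_cases) (auto simp: swap_apply f_in)
  then have "bij_betw swap S S"
    by (intro bij_betw_byWitness[where f' = swap]) blast+
  then show ?thesis
    by (simp add: BijGroup_def Bij_def swap_def glue_def)
qed

lemma swap_swap: "swap \<otimes>\<^bsub>BijGroup S\<^esub> swap = \<one>\<^bsub>BijGroup S\<^esub>"
proof (rule BijGroup_eqI[where S = S])
  fix s assume s: "s \<in> S"
  then have "swap (swap s) = s"
    by (rule S_cases) (auto simp: swap_apply)
  then show "(swap \<otimes>\<^bsub>BijGroup S\<^esub> swap) s = \<one>\<^bsub>BijGroup S\<^esub> s"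
    using s by (simp add: BijGroup_apply swap_carrier BijGroup_one_apply)
qed (use swap_carrier in simp_all)

lemma swap_neq_one: "S1 \<noteq> {} \<Longrightarrow> swap \<noteq> \<one>\<^bsub>BijGroup S\<^esub>"
proof
  assume "S1 \<noteq> {}" and one: "swap = \<one>\<^bsub>BijGroup S\<^esub>"
  then obtain a where a: "a \<in> S1"
    by blast
  then have "swap a = a"
    unfolding one by (simp add: BijGroup_one_apply)
  then show False
    using a swap_apply(1) f_notin by metis
qed

lemma transport_hom: "transport \<in> hom (BijGroup S1) (BijGroup S2)"
proof (rule homI)
  show closed: "transport h \<in> carrier (BijGroup S2)" if h: "h \<in> carrier (BijGroup S1)" for h
  proof -
    have "bij_betw h S1 S1"
      using h by (simp add: BijGroup_def Bij_def)
    then have "bij_betw (f \<circ> h \<circ> inv_into S1 f) S2 S2"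
      using bij bij_betw_inv_into[OF bij] by (blast intro: bij_betw_trans)
    then have "bij_betw (transport h) S2 S2"
      by (rule bij_betw_cong[THEN iffD1, rotated]) (simp add: transport_def)
    then show ?thesis
      by (simp add: BijGroup_def Bij_def transport_def)
  qed
  fix x y assume xy: "x \<in> carrier (BijGroup S1)" "y \<in> carrier (BijGroup S1)"
  show "transport (x \<otimes>\<^bsub>BijGroup S1\<^esub> y) = transport x \<otimes>\<^bsub>BijGroup S2\<^esub> transport y"
  proof (rule BijGroup_eqI[where S = S2])
    fix s assume "s \<in> S2"
    then obtain a where a: "a \<in> S1" "s = f a"
      by (rule f_cases)
    have "y a \<in> S1"
      using xy(2) a(1) by (rule BijGroup_closed)
    then show "transport (x \<otimes>\<^bsub>BijGroup S1\<^esub> y) s = (transport x \<otimes>\<^bsub>BijGroup S2\<^esub> transport y) s"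
      using a xy by (simp add: BijGroup_apply closed transport_apply f_in)
  qed (use closed xy group.is_monoid[OF group_BijGroup] in \<open>auto intro: monoid.m_closed\<close>)
qed

lemma double_closed:
  assumes h: "h \<in> carrier (BijGroup S1)"
  shows "double h \<in> carrier (BijGroup S)" "double h ` S1 = S1" "double h ` S2 = S2"
proof -
  have "bij_betw h S1 S1" "bij_betw (transport h) S2 S2"
    using h hom_in_carrier[OF transport_hom h] by (simp_all add: BijGroup_def Bij_def)
  moreover have "bij_betw (double h) S1 S1 = bij_betw h S1 S1"
    by (rule bij_betw_cong) (simp add: double_apply)
  moreover have "bij_betw (double h) S2 S2 = bij_betw (transport h) S2 S2"
    using disjoint by (intro bij_betw_cong) (auto simp: double_def glue_def)
  ultimately have *: "bij_betw (double h) S1 S1" "bij_betw (double h) S2 S2"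
    by simp_all
  then have "bij_betw (double h) S S"
    using disjoint by (intro bij_betw_combine)
  then show "double h \<in> carrier (BijGroup S)"
    by (simp add: BijGroup_def Bij_def double_def glue_def)
  show "double h ` S1 = S1" "double h ` S2 = S2"
    using * bij_betw_imp_surj_on by blast+
qed

lemma double_hom: "double \<in> hom (BijGroup S1) (BijGroup S)"
proof (rule homI)
  fix x y assume xy: "x \<in> carrier (BijGroup S1)" "y \<in> carrier (BijGroup S1)"
  show "double (x \<otimes>\<^bsub>BijGroup S1\<^esub> y) = double x \<otimes>\<^bsub>BijGroup S\<^esub> double y"
  proof (rule BijGroup_eqI[where S = S])
    fix s assume s: "s \<in> S"
    then obtain a where a: "a \<in> S1" "s = a \<or> s = f a"
      by (rule S_cases)
    have "y a \<in> S1"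
      using xy(2) a(1) by (rule BijGroup_closed)
    then show "double (x \<otimes>\<^bsub>BijGroup S1\<^esub> y) s = (double x \<otimes>\<^bsub>BijGroup S\<^esub> double y) s"
      using a xy s by (auto simp: BijGroup_apply double_closed double_apply f_in f_notin)
  qed (use double_closed(1) xy in simp_all)
qed (rule double_closed(1))

lemma double_eqD:
  assumes "x \<in> carrier (BijGroup S1)" "y \<in> carrier (BijGroup S1)" "double x = double y"
  shows "x = y"
proof (rule BijGroup_eqI[where S = S1])
  show "x a = y a" if "a \<in> S1" for a
    using double_apply(1)[OF that, of x] double_apply(1)[OF that, of y] assms(3) by simp
qed (use assms in simp_all)

lemma transport_eqD:
  assumes "x \<in> carrier (BijGroup S1)" "y \<in> carrier (BijGroup S1)" "transport x = transport y"
  shows "x = y"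
proof (rule BijGroup_eqI[where S = S1])
  show "x a = y a" if "a \<in> S1" for a
    using transport_apply[OF that, of x] transport_apply[OF that, of y] assms
      f_eq_iff[OF BijGroup_closed[OF assms(1) that] BijGroup_closed[OF assms(2) that]] by simp
qed (use assms in simp_all)

lemma double_swap_commute:
  assumes h: "h \<in> carrier (BijGroup S1)"
  shows "double h \<otimes>\<^bsub>BijGroup S\<^esub> swap = swap \<otimes>\<^bsub>BijGroup S\<^esub> double h"
proof -
  have "double h (swap s) = swap (double h s)" if s: "s \<in> S" for s
  proof -
    obtain a where a: "a \<in> S1" "s = a \<or> s = f a"
      using s by (rule S_cases)
    have "h a \<in> S1"
      using h a(1) by (rule BijGroup_closed)
    then show ?thesis
      using a by (auto simp: double_apply swap_apply)
  qed
  then show ?thesis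
    by (simp add: BijGroup_commute_iff[OF double_closed(1)[OF h] swap_carrier])
qed

lemma equivariant_swap:
  assumes "\<And>g. g \<in> carrier K \<Longrightarrow> \<exists>h\<in>carrier (BijGroup S1). \<psi> g = double h"
  shows "equivariant K S \<psi> \<psi> swap"
  unfolding equivariant_def
proof (intro ballI)
  fix g s assume g: "g \<in> carrier K" and s: "s \<in> S"
  obtain h where h: "h \<in> carrier (BijGroup S1)" "\<psi> g = double h"
    using assms[OF g] by blast
  then show "swap (\<psi> g s) = \<psi> g (swap s)"
    using double_swap_commute[OF h(1)] s
      BijGroup_commute_iff[OF double_closed(1)[OF h(1)] swap_carrier] by simp
qed

lemma swap_double_apply:
  assumes h: "h \<in> carrier (BijGroup S1)"
  shows "s \<in> S1 \<Longrightarrow> (swap \<otimes>\<^bsub>BijGroup S\<^esub> double h) s = f (h s)"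
    and "s \<in> S2 \<Longrightarrow> (swap \<otimes>\<^bsub>BijGroup S\<^esub> double h) s = h (inv_into S1 f s)"
proof -
  note app = BijGroup_apply[OF swap_carrier double_closed(1)[OF h]]
  show "(swap \<otimes>\<^bsub>BijGroup S\<^esub> double h) s = f (h s)" if s: "s \<in> S1"
    using BijGroup_closed[OF h s] s by (simp add: app double_apply swap_apply)
  show "(swap \<otimes>\<^bsub>BijGroup S\<^esub> double h) s = h (inv_into S1 f s)" if "s \<in> S2"
  proof -
    obtain a where a: "a \<in> S1" "s = f a"
      using \<open>s \<in> S2\<close> by (rule f_cases)
    then show ?thesis
      using BijGroup_closed[OF h a(1)] by (simp add: app double_apply swap_apply f_in inv_f)
  qed
qed

lemma subgroup_double:
  assumes "subgroup P (BijGroup S1)"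
  shows "subgroup (double ` P) (BijGroup S)"
proof -
  have "group_hom (BijGroup S1) (BijGroup S) double"
    using double_hom by (simp add: group_hom_def group_hom_axioms_def group_BijGroup)
  then show ?thesis
    using assms by (rule group_hom.subgroup_img_is_subgroup)
qed

abbreviation swap_group where "swap_group \<equiv> generate (BijGroup S) {swap}"

abbreviation doubled_group where
  "doubled_group P \<equiv> generate (BijGroup S) (double ` P \<union> {swap})"

lemma preserves_double: "h \<in> carrier (BijGroup S1) \<Longrightarrow> preserves S1 S2 (double h)"
  by (simp add: preserves_def double_closed)

lemma exchanges_swap_double:
  assumes h: "h \<in> carrier (BijGroup S1)"
  shows "exchanges S1 S2 (swap \<otimes>\<^bsub>BijGroup S\<^esub> double h)"
proof -
  have "(swap \<otimes>\<^bsub>BijGroup S\<^esub> double h) ` T = swap ` (double h ` T)" if "T \<subseteq> S" for T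
    unfolding image_image using that
    by (intro image_cong) (auto simp: BijGroup_apply[OF swap_carrier double_closed(1)[OF h]])
  then show ?thesis
    by (simp add: exchanges_def double_closed[OF h] swap_image)
qed

text \<open>
  Preserving and exchanging the two disjoint halves exclude each other, unless everything is empty;
  in that case any two permutations are equal. This form lets the empty set be treated along with
  the general case.
\<close>

lemma preserves_exchanges_eq:
  assumes "preserves S1 S2 t" "exchanges S1 S2 t"
    and "x \<in> carrier (BijGroup S)" "y \<in> carrier (BijGroup S)"
  shows "x = y"
proof -
  have "S1 = S2"
    using assms(1,2) unfolding preserves_def exchanges_def by metis
  then have "S = {}"
    using disjoint by simp
  then show ?thesis
    using assms(3,4) by (metis BijGroup_empty_eq)
qed

context
  fixes P
  assumes P: "subgroup P (BijGroup S1)"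
begin

lemma P_carrier: "h \<in> P \<Longrightarrow> h \<in> carrier (BijGroup S1)"
  using P by (rule subgroup.mem_carrier)

lemma swap_eq_one_if_double: "swap \<in> double ` P \<Longrightarrow> swap = \<one>\<^bsub>BijGroup S\<^esub>"
proof -
  assume "swap \<in> double ` P"
  then have "preserves S1 S2 swap"
    by (metis imageE P_carrier preserves_double)
  moreover have "exchanges S1 S2 swap"
    by (simp add: exchanges_def swap_image)
  ultimately show ?thesis
    using swap_carrier B.one_closed by (rule preserves_exchanges_eq)
qed

lemma double_image_swap_commute: "a \<in> double ` P \<Longrightarrow> a \<otimes>\<^bsub>BijGroup S\<^esub> swap = swap \<otimes>\<^bsub>BijGroup S\<^esub> a"
  using double_swap_commute P_carrier by auto

lemma adjoin_swap:
  shows "swap <#\<^bsub>BijGroup S\<^esub> double ` P = double ` P #>\<^bsub>BijGroup S\<^esub> swap"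
    and "doubled_group P = double ` P \<union> (swap <#\<^bsub>BijGroup S\<^esub> double ` P)"
    and "\<forall>a\<in>double ` P. \<forall>t\<in>swap_group. a \<otimes>\<^bsub>BijGroup S\<^esub> t = t \<otimes>\<^bsub>BijGroup S\<^esub> a"
    and "internal_direct_product (perm_grp S (doubled_group P)) (double ` P) swap_group"
  by (rule B.adjoin_commuting_involution[OF subgroup_double[OF P] swap_carrier swap_swap];
      erule double_image_swap_commute swap_eq_one_if_double)+

lemma doubled_group_right_coset:
  "doubled_group P = double ` P \<union> (double ` P #>\<^bsub>BijGroup S\<^esub> swap)"
  unfolding adjoin_swap(1)[symmetric] by (rule adjoin_swap(2))

lemma subgroup_doubled_group: "subgroup (doubled_group P) (BijGroup S)"
  using P_carrier double_closed(1) swap_carrier by (intro B.generate_is_subgroup) auto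

lemma preserves_doubled_group: "double ` P = {t \<in> doubled_group P. preserves S1 S2 t}"
  and exchanges_doubled_group:
    "swap <#\<^bsub>BijGroup S\<^esub> double ` P = {t \<in> doubled_group P. exchanges S1 S2 t}"
  and disjoint_coset:
    "S1 \<noteq> {} \<Longrightarrow> double ` P \<inter> (swap <#\<^bsub>BijGroup S\<^esub> double ` P) = {}"
proof -
  let ?A = "double ` P" and ?C = "swap <#\<^bsub>BijGroup S\<^esub> double ` P"
  have un: "doubled_group P = ?A \<union> ?C"
    by (rule adjoin_swap)
  have pres: "preserves S1 S2 t" if "t \<in> ?A" for t
    using that by (metis imageE P_carrier preserves_double)
  have exch: "exchanges S1 S2 t" if "t \<in> ?C" for t
    using that exchanges_swap_double P_carrier by (auto simp: l_coset_def)
  have carr: "t \<in> carrier (BijGroup S)" if "t \<in> ?A \<union> ?C" for t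
    using that subgroup.mem_carrier[OF subgroup_doubled_group] un by blast
  have A: "\<one>\<^bsub>BijGroup S\<^esub> \<in> ?A"
    using subgroup_double[OF P] by (rule subgroup.one_closed)
  then have C: "swap \<otimes>\<^bsub>BijGroup S\<^esub> \<one>\<^bsub>BijGroup S\<^esub> \<in> ?C"
    unfolding l_coset_def by blast
  have "t \<in> ?A" if "t \<in> ?C" "preserves S1 S2 t" for t
  proof -
    have "t = \<one>\<^bsub>BijGroup S\<^esub>"
      using that(2) exch[OF that(1)] carr[OF UnI2[OF that(1)]] B.one_closed
      by (rule preserves_exchanges_eq)
    then show ?thesis
      using A by simp
  qed
  then show "?A = {t \<in> doubled_group P. preserves S1 S2 t}"
    using un pres by blast
  have "t \<in> ?C" if "t \<in> ?A" "exchanges S1 S2 t" for t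
  proof -
    have "t = swap \<otimes>\<^bsub>BijGroup S\<^esub> \<one>\<^bsub>BijGroup S\<^esub>"
      using pres[OF that(1)] that(2) carr[OF UnI1[OF that(1)]] carr[OF UnI2[OF C]]
      by (rule preserves_exchanges_eq)
    then show ?thesis
      using C by simp
  qed
  then show "?C = {t \<in> doubled_group P. exchanges S1 S2 t}"
    using un exch by blast
  show "?A \<inter> ?C = {}" if "S1 \<noteq> {}"
  proof (rule ccontr)
    assume "?A \<inter> ?C \<noteq> {}"
    then obtain t where t: "t \<in> ?A" "t \<in> ?C"
      by blast
    have "swap = \<one>\<^bsub>BijGroup S\<^esub>"
      using pres[OF t(1)] exch[OF t(2)] swap_carrier B.one_closed
      by (rule preserves_exchanges_eq)
    then show False
      using swap_neq_one that by blast
  qed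
qed

lemma doubled_group_split_exact:
  "\<exists>\<pi>.
    (\<forall>g\<in>double ` P. \<forall>i::int. \<pi> (g \<otimes>\<^bsub>BijGroup S\<^esub> (swap [^]\<^bsub>BijGroup S\<^esub> i)) = swap [^]\<^bsub>BijGroup S\<^esub> i) \<and>
    exact_seq
      ([perm_grp S {\<one>\<^bsub>BijGroup S\<^esub>}, perm_grp S swap_group, perm_grp S (doubled_group P),
        perm_grp S (double ` P), perm_grp S {\<one>\<^bsub>BijGroup S\<^esub>}],
       [\<lambda>_. \<one>\<^bsub>BijGroup S\<^esub>, \<pi>, \<lambda>t. t, \<lambda>t. t]) \<and>
    left_split (perm_grp S (double ` P)) (\<lambda>t. t) (perm_grp S (doubled_group P)) \<and>
    iso_direct_product_seq (perm_grp S (double ` P)) (\<lambda>t. t) (perm_grp S (doubled_group P)) \<pi>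
      (perm_grp S swap_group)"
proof -
  have powers: "swap [^]\<^bsub>BijGroup S\<^esub> i \<in> swap_group" for i :: int
    unfolding B.generate_pow[OF swap_carrier] by blast
  have "group (perm_grp S (doubled_group P))"
    by (rule B.subgroup_imp_group[OF subgroup_doubled_group])
  then have "\<exists>\<pi>.
    (\<forall>a\<in>double ` P. \<forall>b\<in>swap_group. \<pi> (a \<otimes>\<^bsub>BijGroup S\<^esub> b) = b) \<and>
    exact_seq
      ([perm_grp S {\<one>\<^bsub>BijGroup S\<^esub>}, perm_grp S swap_group, perm_grp S (doubled_group P),
        perm_grp S (double ` P), perm_grp S {\<one>\<^bsub>BijGroup S\<^esub>}],
       [\<lambda>_. \<one>\<^bsub>BijGroup S\<^esub>, \<pi>, \<lambda>t. t, \<lambda>t. t]) \<and>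
    left_split (perm_grp S (double ` P)) (\<lambda>t. t) (perm_grp S (doubled_group P)) \<and>
    iso_direct_product_seq (perm_grp S (double ` P)) (\<lambda>t. t) (perm_grp S (doubled_group P)) \<pi>
      (perm_grp S swap_group)"
    using internal_direct_product_split_exact[OF _ adjoin_swap(4)]
    by (simp del: exact_seq_cons_iff exact_seq_end_iff)
  then show ?thesis
    using powers by blast
qed

text \<open>
  If \<open>p a = b\<close>, then \<open>double p\<close> carries \<open>a\<close> to \<open>b\<close> and \<open>f a\<close> to \<open>f b\<close>, and following it by the swap
  gives the two remaining combinations.
\<close>

lemma doubled_group_transitive:
  assumes trans: "\<And>a b. \<lbrakk> a \<in> S1; b \<in> S1 \<rbrakk> \<Longrightarrow> \<exists>p\<in>P. p a = b"
    and s: "s \<in> S" and t: "t \<in> S"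
  shows "\<exists>q\<in>doubled_group P. q s = t"
proof -
  obtain a where a: "a \<in> S1" "s = a \<or> s = f a"
    using s by (rule S_cases)
  obtain b where b: "b \<in> S1" "t = b \<or> t = f b"
    using t by (rule S_cases)
  obtain p where p: "p \<in> P" "p a = b"
    using trans a b by blast
  have "double p \<in> doubled_group P" "swap \<otimes>\<^bsub>BijGroup S\<^esub> double p \<in> doubled_group P"
    using p(1) by (auto intro: generate.intros)
  moreover have "double p s = t \<or> (swap \<otimes>\<^bsub>BijGroup S\<^esub> double p) s = t"
    using a b p s
    by (auto simp: BijGroup_apply swap_carrier double_closed P_carrier double_apply swap_apply f_notin)
  ultimately show ?thesis
    by blast
qed

lemma faithful_double: "faithful_action (perm_grp S1 P) S double"
  using group_action_perm_grp[OF P double_hom] double_eqD P_carrier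
  by (auto simp: faithful_action_def faithful_action_axioms_def intro!: inj_onI)

lemma faithful_transport: "faithful_action (perm_grp S1 P) S2 transport"
  using group_action_perm_grp[OF P transport_hom] transport_eqD P_carrier
  by (auto simp: faithful_action_def faithful_action_axioms_def intro!: inj_onI)

end

text \<open>
  The generators of the two doubled groups commute and both groups are transitive, which suffices
  for duality.
\<close>

lemma lewin_dual_doubled_groups:
  assumes dual: "lewin_dual S1 P Q"
  shows "lewin_dual S (doubled_group P) (doubled_group Q)"
proof -
  have P: "subgroup P (BijGroup S1)" and Q: "subgroup Q (BijGroup S1)"
    and st: "simply_transitive_action (perm_grp S1 P) S1 (\<lambda>t. t)"
      "simply_transitive_action (perm_grp S1 Q) S1 (\<lambda>t. t)"
    and PQ: "P = centralizer (BijGroup S1) Q"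
    using dual unfolding lewin_dual_def by blast+
  have commPQ: "p \<otimes>\<^bsub>BijGroup S1\<^esub> q = q \<otimes>\<^bsub>BijGroup S1\<^esub> p" if "p \<in> P" "q \<in> Q" for p q
    using that PQ by (auto simp: centralizer_def)
  have comm: "a \<otimes>\<^bsub>BijGroup S\<^esub> b = b \<otimes>\<^bsub>BijGroup S\<^esub> a"
    if ab: "a \<in> double ` P \<union> {swap}" "b \<in> double ` Q \<union> {swap}" for a b
  proof -
    have "double p \<otimes>\<^bsub>BijGroup S\<^esub> double q = double q \<otimes>\<^bsub>BijGroup S\<^esub> double p"
      if "p \<in> P" "q \<in> Q" for p q
      using commPQ[OF that] hom_mult[OF double_hom] P_carrier[OF P that(1)] P_carrier[OF Q that(2)]
      by metis
    then show ?thesis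
      using ab double_image_swap_commute[OF P] double_image_swap_commute[OF Q] by auto
  qed
  have trans: "\<exists>p\<in>R. p x = y"
    if "subgroup R (BijGroup S1)" "simply_transitive_action (perm_grp S1 R) S1 (\<lambda>t. t)"
      "x \<in> S1" "y \<in> S1" for R x y
    using iffD1[OF simply_transitive_perm_grp_iff[OF that(1)] that(2)] that(3,4) by blast
  have carr: "double ` R \<union> {swap} \<subseteq> carrier (BijGroup S)" if "subgroup R (BijGroup S1)" for R
    using P_carrier[OF that] double_closed(1) swap_carrier by auto
  show ?thesis
  proof (rule lewin_dual_if_commuting_transitive)
    show "p \<otimes>\<^bsub>BijGroup S\<^esub> q = q \<otimes>\<^bsub>BijGroup S\<^esub> p"
      if "p \<in> doubled_group P" "q \<in> doubled_group Q" for p q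
      using carr[OF P] carr[OF Q] comm that by (rule B.commuting_generate)
    show "\<exists>p\<in>doubled_group P. p x = y" if "x \<in> S" "y \<in> S" for x y
      using doubled_group_transitive[OF P trans[OF P st(1)] that] .
    show "\<exists>q\<in>doubled_group Q. q x = y" if "x \<in> S" "y \<in> S" for x y
      using doubled_group_transitive[OF Q trans[OF Q st(2)] that] .
  qed (rule subgroup_doubled_group[OF P] subgroup_doubled_group[OF Q])+
qed

end

section \<open>The doubled action and its Lewin dual\<close>

theorem theorem3p1:
  fixes G :: "('g, 'm) monoid_scheme"
    and S1 S2 Sbar :: "'a set"
    and \<phi>1 \<phi>2 \<phi>bar :: "'g \<Rightarrow> 'a \<Rightarrow> 'a"
    and f fbar :: "'a \<Rightarrow> 'a"
    and F G' Gbar H H' Hbar :: "('a \<Rightarrow> 'a) set"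
    and conj ext :: "('a \<Rightarrow> 'a) \<Rightarrow> 'a \<Rightarrow> 'a"
  assumes act1: "faithful_action G S1 \<phi>1"
    and act2: "faithful_action G S2 \<phi>2"
    and disj: "S1 \<inter> S2 = {}"
    and bij: "bij_betw f S1 S2"
    and equiv: "equivariant G S1 \<phi>1 \<phi>2 f"
    and Sbar: "Sbar = S1 \<union> S2"
    and fbar: "fbar = glue S1 S2 f (inv_into S1 f)"
    and \<phi>bar: "\<phi>bar = (\<lambda>g. glue S1 S2 (\<phi>1 g) (\<phi>2 g))"
    and G': "G' = \<phi>bar ` carrier G"
    and F: "F = generate (BijGroup Sbar) {fbar}"
    and Gbar: "Gbar = generate (BijGroup Sbar) (G' \<union> {fbar})"
    and H: "H = centralizer (BijGroup S1) (\<phi>1 ` carrier G)"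
    and conj: "conj = (\<lambda>h. \<lambda>s\<in>S2. f (h (inv_into S1 f s)))"
    and ext: "ext = (\<lambda>h. glue S1 S2 h (conj h))"
    and H': "H' = ext ` H"
    and Hbar: "Hbar = generate (BijGroup Sbar) (H' \<union> {fbar})"
  shows
    "faithful_action G Sbar \<phi>bar \<and>
     \<comment> \<open>(1)\<close>
     (fbar \<in> carrier (BijGroup Sbar) \<and>
        equivariant G Sbar \<phi>bar \<phi>bar fbar \<and>
        fbar \<otimes>\<^bsub>BijGroup Sbar\<^esub> fbar = \<one>\<^bsub>BijGroup Sbar\<^esub> \<and>
        (S1 \<noteq> {} \<longrightarrow> fbar \<noteq> \<one>\<^bsub>BijGroup Sbar\<^esub>)) \<and>
     \<comment> \<open>(2)\<close>
     ((\<forall>g\<in>G'. \<forall>t\<in>F. g \<otimes>\<^bsub>BijGroup Sbar\<^esub> t = t \<otimes>\<^bsub>BijGroup Sbar\<^esub> g) \<and>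
        internal_direct_product (perm_grp Sbar Gbar) G' F \<and>
        Gbar = G' \<union> (fbar <#\<^bsub>BijGroup Sbar\<^esub> G') \<and>
        Gbar = G' \<union> (G' #>\<^bsub>BijGroup Sbar\<^esub> fbar) \<and>
        fbar <#\<^bsub>BijGroup Sbar\<^esub> G' = G' #>\<^bsub>BijGroup Sbar\<^esub> fbar \<and>
        (S1 \<noteq> {} \<longrightarrow> G' \<inter> (fbar <#\<^bsub>BijGroup Sbar\<^esub> G') = {}) \<and>
        G' = {t \<in> Gbar. preserves S1 S2 t} \<and>
        fbar <#\<^bsub>BijGroup Sbar\<^esub> G' = {t \<in> Gbar. exchanges S1 S2 t}) \<and>
     \<comment> \<open>(3)\<close>
     (\<exists>\<pi>.
          (\<forall>g\<in>G'. \<forall>i::int. \<pi> (g \<otimes>\<^bsub>BijGroup Sbar\<^esub> (fbar [^]\<^bsub>BijGroup Sbar\<^esub> i)) =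
              fbar [^]\<^bsub>BijGroup Sbar\<^esub> i) \<and>
          exact_seq
            ([perm_grp Sbar {\<one>\<^bsub>BijGroup Sbar\<^esub>}, perm_grp Sbar F, perm_grp Sbar Gbar,
              perm_grp Sbar G', perm_grp Sbar {\<one>\<^bsub>BijGroup Sbar\<^esub>}],
             [\<lambda>_. \<one>\<^bsub>BijGroup Sbar\<^esub>, \<pi>, \<lambda>t. t, \<lambda>t. t]) \<and>
          left_split (perm_grp Sbar G') (\<lambda>t. t) (perm_grp Sbar Gbar) \<and>
          iso_direct_product_seq (perm_grp Sbar G') (\<lambda>t. t) (perm_grp Sbar Gbar) \<pi>
            (perm_grp Sbar F)) \<and>
     \<comment> \<open>(4)\<close>
     (simply_transitive_action G S1 \<phi>1 \<longrightarrow>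
        simply_transitive_action G S2 \<phi>2 \<and>
        simply_transitive_action (perm_grp Sbar Gbar) Sbar (\<lambda>t. t)) \<and>
     \<comment> \<open>(5)\<close>
     (simply_transitive_action G S1 \<phi>1 \<longrightarrow>
        lewin_dual S1 (\<phi>1 ` carrier G) H \<and>
        faithful_action (perm_grp S1 H) S2 conj \<and>
        equivariant (perm_grp S1 H) S1 (\<lambda>h. h) conj f \<and>
        faithful_action (perm_grp S1 H) Sbar ext \<and>
        Hbar = centralizer (BijGroup Sbar) Gbar \<and>
        lewin_dual Sbar Hbar Gbar \<and>
        \<comment> \<open>(i)\<close>
        equivariant (perm_grp S1 H) Sbar ext ext fbar \<and>
        \<comment> \<open>(ii)\<close>
        (\<forall>g\<in>H'. \<forall>t\<in>F. g \<otimes>\<^bsub>BijGroup Sbar\<^esub> t = t \<otimes>\<^bsub>BijGroup Sbar\<^esub> g) \<and>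
        internal_direct_product (perm_grp Sbar Hbar) H' F \<and>
        Hbar = H' \<union> (fbar <#\<^bsub>BijGroup Sbar\<^esub> H') \<and>
        Hbar = H' \<union> (H' #>\<^bsub>BijGroup Sbar\<^esub> fbar) \<and>
        fbar <#\<^bsub>BijGroup Sbar\<^esub> H' = H' #>\<^bsub>BijGroup Sbar\<^esub> fbar \<and>
        (S1 \<noteq> {} \<longrightarrow> H' \<inter> (fbar <#\<^bsub>BijGroup Sbar\<^esub> H') = {}) \<and>
        H' = {t \<in> Hbar. preserves S1 S2 t} \<and>
        fbar <#\<^bsub>BijGroup Sbar\<^esub> H' = {t \<in> Hbar. exchanges S1 S2 t} \<and>
        \<comment> \<open>(iii)\<close>
        (\<exists>\<pi>.
          (\<forall>g\<in>H'. \<forall>i::int. \<pi> (g \<otimes>\<^bsub>BijGroup Sbar\<^esub> (fbar [^]\<^bsub>BijGroup Sbar\<^esub> i)) =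
              fbar [^]\<^bsub>BijGroup Sbar\<^esub> i) \<and>
          exact_seq
            ([perm_grp Sbar {\<one>\<^bsub>BijGroup Sbar\<^esub>}, perm_grp Sbar F, perm_grp Sbar Hbar,
              perm_grp Sbar H', perm_grp Sbar {\<one>\<^bsub>BijGroup Sbar\<^esub>}],
             [\<lambda>_. \<one>\<^bsub>BijGroup Sbar\<^esub>, \<pi>, \<lambda>t. t, \<lambda>t. t]) \<and>
          left_split (perm_grp Sbar H') (\<lambda>t. t) (perm_grp Sbar Hbar) \<and>
          iso_direct_product_seq (perm_grp Sbar H') (\<lambda>t. t) (perm_grp Sbar Hbar) \<pi>
            (perm_grp Sbar F)) \<and>
        \<comment> \<open>(iv)\<close>
        simply_transitive_action (perm_grp S1 H) S2 conj \<and>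
        simply_transitive_action (perm_grp Sbar Hbar) Sbar (\<lambda>t. t)) \<and>
     \<comment> \<open>(6)\<close>
     (simply_transitive_action G S1 \<phi>1 \<longrightarrow>
        (\<forall>h\<in>H.
          fbar \<otimes>\<^bsub>BijGroup Sbar\<^esub> ext h = ext h \<otimes>\<^bsub>BijGroup Sbar\<^esub> fbar \<and>
          (\<forall>s\<in>S1. (fbar \<otimes>\<^bsub>BijGroup Sbar\<^esub> ext h) s = f (h s)) \<and>
          (\<forall>s\<in>S2. (fbar \<otimes>\<^bsub>BijGroup Sbar\<^esub> ext h) s = h (inv_into S1 f s))))"
proof -
  interpret A1: faithful_action G S1 \<phi>1 by (rule act1)
  interpret A2: faithful_action G S2 \<phi>2 by (rule act2)
  interpret D: doubled_set S1 S2 f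
    using disj bij by (rule doubled_set.intro)
  define P where "P = \<phi>1 ` carrier G"
  have P: "subgroup P (BijGroup S1)"
    unfolding P_def by (rule A1.subgroup_image)
  have H_eq: "H = centralizer (BijGroup S1) P"
    unfolding H P_def ..
  have subH: "subgroup H (BijGroup S1)"
    unfolding H_eq using subgroup.subset[OF P] by (rule D.B1.subgroup_centralizer)
  have fbar_eq: "fbar = D.swap" and conj_eq: "conj = D.transport"
    unfolding fbar conj D.swap_def D.transport_def by (rule refl)+
  have ext_eq: "ext = D.double"
    unfolding ext conj_eq D.double_def by (rule refl)
  have \<phi>1: "\<phi>1 g \<in> carrier (BijGroup S1)" if "g \<in> carrier G" for g
    using A1.bij_prop0[OF that] by (simp add: BijGroup_def)
  \<comment> \<open>this is where equivariance of \<open>f\<close> enters: the given action on \<open>S2\<close> is the transported one\<close>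
  have \<phi>bar_eq: "\<phi>bar g = D.double (\<phi>1 g)" if g: "g \<in> carrier G" for g
  proof
    have "\<phi>2 g (f a) = f (\<phi>1 g a)" if "a \<in> S1" for a
      using equiv g that by (simp add: equivariant_def)
    then have "\<phi>2 g s = D.transport (\<phi>1 g) s" if "s \<in> S2" for s
      using that by (metis D.f_cases D.transport_apply)
    then show "\<phi>bar g s = D.double (\<phi>1 g) s" for s
      by (simp add: \<phi>bar D.double_def glue_def restrict_def)
  qed
  have G'_eq: "G' = D.double ` P"
    unfolding G' P_def image_image by (rule image_cong) (simp_all add: \<phi>bar_eq)
  note eqs = Sbar F Gbar Hbar H' G'_eq fbar_eq conj_eq ext_eq
  have hom: "\<phi>bar \<in> hom G (BijGroup D.S)"
  proof (rule homI)
    interpret G: group_hom G "BijGroup S1" \<phi>1 by (rule A1.group_hom)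
    show "\<phi>bar g \<in> carrier (BijGroup D.S)" if "g \<in> carrier G" for g
      using that by (simp add: \<phi>bar_eq \<phi>1 D.double_closed)
    show "\<phi>bar (g \<otimes>\<^bsub>G\<^esub> h) = \<phi>bar g \<otimes>\<^bsub>BijGroup D.S\<^esub> \<phi>bar h"
      if "g \<in> carrier G" "h \<in> carrier G" for g h
      using that by (simp add: \<phi>bar_eq \<phi>1 hom_mult[OF D.double_hom])
  qed
  have "inj_on \<phi>bar (carrier G)"
    using D.double_eqD \<phi>1 A1.faithful unfolding inj_on_def by (simp add: \<phi>bar_eq)
  then have faithful: "faithful_action G D.S \<phi>bar"
    using hom A1.group_hom
    by (simp add: faithful_action_def faithful_action_axioms_def group_action_def
        group_hom_def group_hom_axioms_def group_BijGroup)
  have equiv_fbar: "equivariant G D.S \<phi>bar \<phi>bar D.swap"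
    using \<phi>bar_eq \<phi>1 by (intro D.equivariant_swap) blast
  have simply: "simply_transitive_action (perm_grp S1 P) S1 (\<lambda>t. t)"
    if "simply_transitive_action G S1 \<phi>1"
    unfolding P_def using that by (rule simply_transitive_action.simply_transitive_image)
  have dual: "lewin_dual S1 P H" if "simply_transitive_action G S1 \<phi>1"
    unfolding H_eq using P simply[OF that] by (rule lewin_dual_centralizer)
  have dual_bar: "lewin_dual D.S (D.doubled_group H) (D.doubled_group P)"
    if "simply_transitive_action G S1 \<phi>1"
    using lewin_dual_sym[OF dual[OF that]] by (rule D.lewin_dual_doubled_groups)
  have equiv_H: "equivariant (perm_grp S1 H) S1 (\<lambda>h. h) D.transport f"
    by (simp add: equivariant_def D.transport_apply)
  have st2: "simply_transitive_action G S2 \<phi>2" if "simply_transitive_action G S1 \<phi>1"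
    using that A2.group_action_axioms bij equiv by (rule simply_transitive_equivariant)
  have stH2: "simply_transitive_action (perm_grp S1 H) S2 D.transport"
    if "simply_transitive_action G S1 \<phi>1"
    using lewin_dualD(3)[OF dual[OF that]] group_action_perm_grp[OF subH D.transport_hom] bij equiv_H
    by (rule simply_transitive_equivariant)
  have equiv_H_fbar: "equivariant (perm_grp S1 H) D.S D.double D.double D.swap"
    using D.P_carrier[OF subH] by (intro D.equivariant_swap) (auto intro: bexI)
  have six: "\<forall>h\<in>H.
      D.swap \<otimes>\<^bsub>BijGroup D.S\<^esub> D.double h = D.double h \<otimes>\<^bsub>BijGroup D.S\<^esub> D.swap \<and>
      (\<forall>s\<in>S1. (D.swap \<otimes>\<^bsub>BijGroup D.S\<^esub> D.double h) s = f (h s)) \<and>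
      (\<forall>s\<in>S2. (D.swap \<otimes>\<^bsub>BijGroup D.S\<^esub> D.double h) s = h (inv_into S1 f s))"
    using D.swap_double_apply D.P_carrier[OF subH] D.double_swap_commute by simp
  show ?thesis
    unfolding eqs P_def[symmetric]
    by (intro conjI impI)
      (rule faithful D.swap_carrier equiv_fbar D.swap_swap
         D.adjoin_swap[OF P] D.doubled_group_right_coset[OF P]
         D.preserves_doubled_group[OF P] D.exchanges_doubled_group[OF P]
         D.doubled_group_split_exact[OF P]
         equiv_H D.faithful_double[OF subH] D.faithful_transport[OF subH] equiv_H_fbar
         D.adjoin_swap[OF subH] D.doubled_group_right_coset[OF subH]
         D.preserves_doubled_group[OF subH] D.exchanges_doubled_group[OF subH]
         D.doubled_group_split_exact[OF subH] six
       | erule D.swap_neq_one D.disjoint_coset[OF P] D.disjoint_coset[OF subH]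
         st2 stH2 dual dual_bar lewin_dualD[OF dual_bar])+
qed

end
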